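(* For $n\ge1$ let $x_n:=\Phi_2^{-1}(1+q^n)\in\mathbb R_{\rm C}^1$. Then $x_1=2_+$, $x_2=2_-$, and for every $n\ge3$ $$x_n=[[2,2,\overline{2^{(n-3)},4,2^{(n-3)},3}]],$$ where $2^{(r)}$ denotes a string of $r$ copies of $2$. Thus (for $n\ge3$) $$x_n=\frac{n(n+1)-\sqrt{(n-2)(n-1)n(n+1)}}{2n-1},$$ and it is a quadratic irrational. Thus the $x_n$, $n\ge1$, are precisely the points $x$ of $\mathbb R_{\rm C}^1$ for which $\Phi_2(x)$ has exactly one nonzero coefficient of positive degree.
   Context: The Cantor line is $\mathbb R_{\rm C}:=(\mathbb R\setminus\mathbb Q)\sqcup\mathbb Q_+\sqcup\mathbb Q_-\sqcup\{-\infty,+\infty\}$, each rational $r$ being doubled into $r_-<r_+$, ordered in the evident way; $\mathbb R_{\rm C}^1:=[1_+,+\infty]$. $[n]_q=\frac{1-q^n}{1-q}$. For real $x\ge1$ with unique infinite expansion $x=[[c_1,c_2,\ldots]]:=c_1-\frac1{c_2-\frac{1}{c_3-\cdots}}$, integers $c_j\ge2$, $[x]_q\in\mathbb Z[[q]]$ is the $q$-adic limit of $[c_1]_q-\frac{q^{c_1-1}}{[c_2]_q-\cdots\frac{q^{c_{N-1}-1}}{[c_N]_q}}$. For rational $r=[[c_1,\ldots,c_N]]>1$ (finite expansion, $c_i\ge2$), $[r]_q^-$ is the finite expression $[c_1]_q-\frac{q^{c_1-1}}{[c_2]_q-\cdots\frac{q^{c_{N-1}-1}}{[c_N]_q}}$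 with the last entry $[c_N]_q$ replaced by $[c_N]_q-q^{c_N-1}(1-q)$. $\Phi_2:\mathbb R_{\rm C}^1\to1+q\mathbb F_2[[q]]$ is the bijection given by coefficientwise reduction mod $2$: $\Phi_2(x)=[x]_q\bmod2$ for irrational $x$, $\Phi_2(r_+)=[r]_q\bmod2$, $\Phi_2(r_-)=[r]_q^-\bmod2$, $\Phi_2(+\infty)=(1-q)^{-1}$. An overline denotes infinite periodic repetition. *)

theory Defs
  imports
    Complex_Main
    "HOL-Library.Extended_Real"
    "HOL-Library.Z2"
    "HOL-Computational_Algebra.Formal_Power_Series"
begin

section \<open>The Cantor line\<close>

text \<open>
  The raw datatype also contains the points \<open>Irr x\<close> with \<open>x\<close> rational; these are excluded from
  \<open>cantor_line\<close>. \<open>RMinus r\<close> and \<open>RPlus r\<close> are the two copies \<open>r_-\<close> and \<open>r_+\<close> of the rational \<open>r\<close>.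
\<close>

datatype cantor = Irr real | RMinus rat | RPlus rat | MInf | PInf

definition cantor_line :: "cantor set" where
  "cantor_line = Irr ` (- \<rat>) \<union> range RMinus \<union> range RPlus \<union> {MInf, PInf}"

fun cantor_val :: "cantor \<Rightarrow> ereal" where
  "cantor_val (Irr x) = ereal x"
| "cantor_val (RMinus r) = ereal (of_rat r)"
| "cantor_val (RPlus r) = ereal (of_rat r)"
| "cantor_val MInf = -\<infinity>"
| "cantor_val PInf = \<infinity>"

definition cantor_le :: "cantor \<Rightarrow> cantor \<Rightarrow> bool" where
  "cantor_le a b \<longleftrightarrow>
     a = b \<or> cantor_val a < cantor_val b \<or> (\<exists>r. a = RMinus r \<and> b = RPlus r)"

definition cantor_line1 :: "cantor set" where
  "cantor_line1 = {a \<in> cantor_line. cantor_le (RPlus 1) a \<and> cantor_le a PInf}"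

lemma cantor_le_total:
  assumes "a \<in> cantor_line" "b \<in> cantor_line"
  shows "cantor_le a b \<or> cantor_le b a"
  using assms unfolding cantor_line_def cantor_le_def
  by (cases a; cases b) (auto simp: of_rat_less neq_iff Rats_def)

lemma cantor_le_antisym: "cantor_le a b \<Longrightarrow> cantor_le b a \<Longrightarrow> a = b"
  unfolding cantor_le_def by auto

lemma cantor_le_trans: "cantor_le a b \<Longrightarrow> cantor_le b c \<Longrightarrow> cantor_le a c"
  unfolding cantor_le_def by auto

section \<open>Negative continued fractions\<close>

text \<open>The finite expression \<open>[[c_1, ..., c_N]] = c_1 - 1/(c_2 - ... - 1/c_N)\<close>.\<close>

fun hj_fin :: "nat list \<Rightarrow> real" where
  "hj_fin [] = undefined"
| "hj_fin [c] = real c"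
| "hj_fin (c # d # cs) = real c - 1 / hj_fin (d # cs)"

text \<open>
  \<open>x = [[c_1, c_2, ...]]\<close> with all entries at least 2. Sequences are indexed from 0, so
  \<open>c j\<close> is the entry \<open>c_{j+1}\<close>.
\<close>

definition hj_expansion :: "(nat \<Rightarrow> nat) \<Rightarrow> real \<Rightarrow> bool" where
  "hj_expansion c x \<longleftrightarrow>
     (\<forall>j. c j \<ge> 2) \<and> (\<lambda>N. hj_fin (map c [0..<Suc N])) \<longlonglongrightarrow> x"

definition hj_digits :: "real \<Rightarrow> nat \<Rightarrow> nat" where
  "hj_digits x = (THE c. hj_expansion c x)"

definition hj_fin_digits :: "rat \<Rightarrow> nat list" where
  "hj_fin_digits r =
     (THE cs. cs \<noteq> [] \<and> (\<forall>c\<in>set cs. c \<ge> 2) \<and> hj_fin cs = of_rat r)"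

text \<open>The sequence consisting of \<open>pre\<close> followed by infinitely many repetitions of \<open>per\<close>.\<close>

definition ev_periodic :: "'a list \<Rightarrow> 'a list \<Rightarrow> nat \<Rightarrow> 'a" where
  "ev_periodic pre per k =
     (if k < length pre then pre ! k else per ! ((k - length pre) mod length per))"

section \<open>The \<open>q\<close>-deformation\<close>

text \<open>
  The ring of integers is not in class \<open>inverse\<close>, so the inverse of an integral power series with
  constant coefficient 1 is taken with \<open>fps_right_inverse\<close>. All denominators below have constant
  coefficient 1.
\<close>

definition unit_inv :: "int fps \<Rightarrow> int fps" where
  "unit_inv f = fps_right_inverse f 1"

lemma mult_unit_inv: "fps_nth f 0 = 1 \<Longrightarrow> f * unit_inv f = 1"
  unfolding unit_inv_def by (rule fps_right_inverse) simp

definition qint :: "nat \<Rightarrow> int fps" where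
  "qint n = (1 - fps_X ^ n) * unit_inv (1 - fps_X)"

fun qcf :: "nat list \<Rightarrow> int fps" where
  "qcf [] = undefined"
| "qcf [c] = qint c"
| "qcf (c # d # cs) = qint c - fps_X ^ (c - 1) * unit_inv (qcf (d # cs))"

fun qcf_minus :: "nat list \<Rightarrow> int fps" where
  "qcf_minus [] = undefined"
| "qcf_minus [c] = qint c - fps_X ^ (c - 1) * (1 - fps_X)"
| "qcf_minus (c # d # cs) = qint c - fps_X ^ (c - 1) * unit_inv (qcf_minus (d # cs))"

text \<open>
  \<open>[x]_q\<close> for real \<open>x \<ge> 1\<close>, rational or not, from the infinite expansion of \<open>x\<close>. The metric
  topology of \<open>fps\<close> is the \<open>q\<close>-adic one.
\<close>

definition qreal :: "real \<Rightarrow> int fps" where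
  "qreal x = lim (\<lambda>N. qcf (map (hj_digits x) [0..<Suc N]))"

definition qrat_minus :: "rat \<Rightarrow> int fps" where
  "qrat_minus r = qcf_minus (hj_fin_digits r)"

section \<open>Reduction mod 2\<close>

definition reduce2 :: "int fps \<Rightarrow> bit fps" where
  "reduce2 f = Abs_fps (\<lambda>k. of_int (fps_nth f k))"

fun Phi2 :: "cantor \<Rightarrow> bit fps" where
  "Phi2 (Irr x) = reduce2 (qreal x)"
| "Phi2 (RPlus r) = reduce2 (qreal (of_rat r))"
| "Phi2 (RMinus r) = reduce2 (qrat_minus r)"
| "Phi2 PInf = inverse (1 - fps_X)"
| "Phi2 MInf = undefined"

definition xpt :: "nat \<Rightarrow> cantor" where
  "xpt n = inv_into cantor_line1 Phi2 (1 + fps_X ^ n)"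

definition quadratic_irrational :: "real \<Rightarrow> bool" where
  "quadratic_irrational x \<longleftrightarrow>
     x \<notin> \<rat> \<and>
     (\<exists>a b c :: int. a \<noteq> 0 \<and> of_int a * x\<^sup>2 + of_int b * x + of_int c = 0)"

end

theory Submission
  imports Defs
begin

text \<open>
  The digit sequence of a point can be read off from its power series. Indeed
  \<open>f = [c]_q - q^(c-1)/f'\<close> begins with exactly \<open>c - 1\<close> coefficients equal to 1 followed by a zero
  (\<open>qstep_nth_gap\<close>), so \<open>f\<close> determines \<open>c\<close> and then \<open>f'\<close> (\<open>qstep_inj\<close>). The series \<open>1/(1 - q)\<close> is
  the only one without a zero coefficient and serves as the end mark of a terminating expansion: the
  point \<open>r_-\<close> is the finite expansion of \<open>r\<close> followed by \<open>+\<infinity>\<close> (\<open>qcf_minus_eq_foldr\<close>). As points of the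
  Cantor line are in turn determined by their terminating or infinite digit sequences, \<open>Phi2\<close> is
  injective (\<open>Phi2_inj\<close>). Everything thus reduces to exhibiting, for each \<open>n\<close>, one point with image
  \<open>1 + q^n\<close>. The final characterization follows as well, because every image has constant
  coefficient 1 and the only nonzero element of the field with two elements is 1.

  For \<open>n = 1\<close> and \<open>n = 2\<close> the points are the two copies of 2. For \<open>n \<ge> 3\<close> one has to expand \<open>1 + q^n\<close>
  mod 2. A step with digit 2 multiplies \<open>(f - 1)/(f - q)\<close> by \<open>q\<close> (\<open>foldr_qstep_twos_eqI\<close>), so that a
  whole run of twos is one substitution. This gives an explicit fraction that the period
  reproduces and that the preperiod sends to \<open>1 + q^n\<close> (\<open>period_mod_2\<close>). A step with \<open>c \<ge> 2\<close>
  contracts \<open>q\<close>-adically (\<open>qstep_congruent\<close>), so this fixed point is the value of the periodic expansion.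

  The same digits have a real value \<open>x\<close>, determined by the fixed-point equation of the period. Runs of
  twos translate \<open>1/(x - 1)\<close> (\<open>foldr_hjstep_twos\<close>), and the equation becomes
  \<open>(2 n - 1) (y\<^sup>2 + 1) = 2 (n\<^sup>2 - n + 1) y\<close> for \<open>y = x - 1\<close>. Its root in \<open>(0, 1)\<close> is the stated
  formula, and its radicand is one less than a square, hence \<open>x\<close> is irrational. For the link between
  digits and reals it is needed that every \<open>x \<ge> 1\<close> has exactly one infinite expansion
  (\<open>hjval_inj\<close> and \<open>hjval_hj_digits\<close>).
\<close>

section \<open>Congruences modulo powers of the variable\<close>

lemma fps_X_power_dvd_iff:
  fixes f :: "'a::comm_ring_1 fps"
  shows "fps_X ^ k dvd f \<longleftrightarrow> (\<forall>i<k. fps_nth f i = 0)"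
proof
  assume "\<forall>i<k. fps_nth f i = 0"
  hence "f = fps_X ^ k * fps_shift k f"
    by (intro fps_ext) (auto simp: fps_X_power_mult_nth)
  thus "fps_X ^ k dvd f" by (rule dvdI)
qed (auto simp: fps_X_power_mult_nth elim!: dvdE)

lemma fps_eq_if_congruent_mod_all_powers:
  fixes f g :: "'a::comm_ring_1 fps"
  assumes "\<And>k. fps_X ^ k dvd f - g"
  shows "f = g"
proof (rule fps_ext)
  fix n show "fps_nth f n = fps_nth g n"
    using assms[of "Suc n"] by (auto simp: fps_X_power_dvd_iff simp del: power_Suc)
qed

lemma fps_X_power_mult_cancel:
  fixes f g :: "'a::comm_ring_1 fps"
  assumes "fps_X ^ k * f = fps_X ^ k * g"
  shows "f = g"
proof (rule fps_ext)
  fix n show "fps_nth f n = fps_nth g n"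
    using arg_cong[OF assms, of "\<lambda>h. fps_nth h (n + k)"] by (simp add: fps_X_power_mult_nth)
qed

section \<open>The step of a q-deformed continued fraction\<close>

text \<open>
  The inverse of a series with constant coefficient 1. Using the same operation over every
  commutative ring lets the integral series and their reductions share all lemmas.
\<close>

definition one_inv :: "'a::comm_ring_1 fps \<Rightarrow> 'a fps" where
  "one_inv f = fps_right_inverse f 1"

lemma mult_one_inv: "fps_nth f 0 = 1 \<Longrightarrow> f * one_inv f = 1"
  unfolding one_inv_def by (rule fps_right_inverse) simp

lemma one_inv_nth_0 [simp]: "fps_nth (one_inv f) 0 = 1"
  by (simp add: one_inv_def)

lemma one_inv_unique:
  assumes "f * g = 1" "fps_nth f 0 = 1"
  shows "one_inv f = g"
proof -
  have "one_inv f = (f * g) * one_inv f" using assms(1) by simp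
  also have "\<dots> = (f * one_inv f) * g" by (simp only: mult_ac)
  finally show ?thesis by (simp add: mult_one_inv assms(2))
qed

lemma one_inv_inj:
  assumes "one_inv f = one_inv g" "fps_nth f 0 = 1" "fps_nth g 0 = 1"
  shows "f = g"
proof -
  have "f = f * (g * one_inv g)" using assms(3) by (simp add: mult_one_inv)
  also have "\<dots> = (f * one_inv f) * g" using assms(1) by (simp add: mult_ac)
  finally show ?thesis by (simp add: mult_one_inv assms(2))
qed

definition qstep :: "nat \<Rightarrow> 'a::comm_ring_1 fps \<Rightarrow> 'a fps" where
  "qstep c f = (\<Sum>i<c. fps_X ^ i) - fps_X ^ (c - 1) * one_inv f"

lemma sum_fps_X_power_nth:
  "fps_nth (\<Sum>i<c. fps_X ^ i :: 'a::comm_ring_1 fps) k = (if k < c then 1 else 0)"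
  by (induction c) auto

lemma qstep_nth_below:
  assumes "k < c - 1"
  shows "fps_nth (qstep c f) k = 1"
  using assms by (simp add: qstep_def sum_fps_X_power_nth fps_X_power_mult_nth)

text \<open>
  The coefficients of \<open>qstep c f\<close> start with \<open>c - 1\<close> ones, and then comes a zero because the last
  one of \<open>[c]_q\<close> is cancelled by the constant coefficient of \<open>1/f\<close>. So the first zero coefficient
  reveals \<open>c\<close>, over any nonzero ring; this is what makes expansions unique.
\<close>

lemma qstep_nth_gap:
  assumes "c \<ge> 1"
  shows "fps_nth (qstep c f) (c - 1) = 0"
  using assms by (simp add: qstep_def sum_fps_X_power_nth fps_X_power_mult_nth)

lemma qstep_nth_0 [simp]: "c \<ge> 2 \<Longrightarrow> fps_nth (qstep c f) 0 = 1"
  by (simp add: qstep_nth_below)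

lemma qstep_inj:
  fixes f g :: "'a::comm_ring_1 fps"
  assumes eq: "qstep c f = qstep d g" and "c \<ge> 2" "d \<ge> 2" "fps_nth f 0 = 1" "fps_nth g 0 = 1"
  shows "c = d \<and> f = g"
proof -
  have "\<not> c < d" if "c \<ge> 2" "qstep c f = qstep d g" for c d and f g :: "'a fps"
  proof
    assume "c < d"
    hence "c - 1 < d - 1" using \<open>c \<ge> 2\<close> by simp
    thus False using that qstep_nth_gap[of c f] qstep_nth_below[of "c - 1" d g] by simp
  qed
  from this[of c f d g] this[of d g c f] assms have "c = d" by (metis linorder_cases)
  moreover from eq this have "fps_X ^ (c - 1) * one_inv f = fps_X ^ (c - 1) * one_inv g"
    by (simp add: qstep_def)
  ultimately show ?thesis
    using assms by (blast dest: fps_X_power_mult_cancel one_inv_inj)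
qed

text \<open>
  The difference of the two values is \<open>q^(c-1) (f - g) / (f g)\<close>, so a step with \<open>c \<ge> 2\<close> improves
  a congruence by at least one order. Convergence of expansions and uniqueness of fixed points
  both rest on this contraction.
\<close>

lemma qstep_congruent:
  fixes f g :: "'a::comm_ring_1 fps"
  assumes "c \<ge> 2" "fps_nth f 0 = 1" "fps_nth g 0 = 1" "fps_X ^ k dvd f - g"
  shows "fps_X ^ Suc k dvd qstep c f - qstep c g"
proof -
  have "one_inv g - one_inv f = one_inv f * one_inv g * (f - g)"
  proof -
    have "one_inv f * one_inv g * (f - g) = (f * one_inv f) * one_inv g - (g * one_inv g) * one_inv f"
      by (simp add: algebra_simps)
    thus ?thesis by (simp add: mult_one_inv assms(2,3))
  qed
  moreover have "qstep c f - qstep c g = fps_X ^ (c - 1) * (one_inv g - one_inv f)"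
    by (simp add: qstep_def right_diff_distrib)
  ultimately have "qstep c f - qstep c g = fps_X ^ (c - 1) * (f - g) * (one_inv f * one_inv g)"
    by (simp only: mult_ac)
  moreover have "fps_X ^ Suc k dvd fps_X ^ (c - 1) * (f - g)"
  proof -
    have "fps_X ^ 1 dvd (fps_X ^ (c - 1) :: 'a fps)"
      using assms(1) by (intro le_imp_power_dvd) auto
    from mult_dvd_mono[OF this assms(4)] show ?thesis by simp
  qed
  ultimately show ?thesis by (simp add: dvd_mult2)
qed

lemma foldr_qstep_nth_0:
  assumes "\<forall>c\<in>set cs. c \<ge> 2" "fps_nth f 0 = 1"
  shows "fps_nth (foldr qstep cs f) 0 = 1"
  using assms by (cases cs) auto

lemma foldr_qstep_congruent:
  fixes f g :: "'a::comm_ring_1 fps"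
  assumes "\<forall>c\<in>set cs. c \<ge> 2" "fps_nth f 0 = 1" "fps_nth g 0 = 1" "fps_X ^ k dvd f - g"
  shows "fps_X ^ (length cs + k) dvd foldr qstep cs f - foldr qstep cs g"
  using assms
proof (induction cs)
  case (Cons c cs)
  thus ?case
    using qstep_congruent[of c "foldr qstep cs f" "foldr qstep cs g" "length cs + k"]
    by (simp add: foldr_qstep_nth_0)
qed simp

lemma foldr_qstep_congruent_length:
  fixes f g :: "'a::comm_ring_1 fps"
  assumes "\<forall>c\<in>set cs. c \<ge> 2" "fps_nth f 0 = 1" "fps_nth g 0 = 1"
  shows "fps_X ^ Suc (length cs) dvd foldr qstep cs f - foldr qstep cs g"
  using foldr_qstep_congruent[OF assms, of 1] assms(2,3) fps_X_power_dvd_iff[of 1 "f - g"] by simp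

lemma foldr_qstep_fixed_point_unique:
  fixes f g :: "'a::comm_ring_1 fps"
  assumes "cs \<noteq> []" "\<forall>c\<in>set cs. c \<ge> 2" "fps_nth f 0 = 1" "fps_nth g 0 = 1"
    and "foldr qstep cs f = f" "foldr qstep cs g = g"
  shows "f = g"
proof (rule fps_eq_if_congruent_mod_all_powers)
  fix k show "fps_X ^ k dvd f - g"
  proof (induction k)
    case (Suc k)
    have "fps_X ^ (length cs + k) dvd f - g"
      using foldr_qstep_congruent[OF assms(2-4) Suc] assms(5,6) by simp
    moreover have "Suc k \<le> length cs + k" using assms(1) by (cases cs) auto
    ultimately show ?case by (meson dvd_trans le_imp_power_dvd)
  qed simp
qed

section \<open>Infinite and terminating expansions of power series\<close>

text \<open>
  The \<open>q\<close>-adic value of an infinite expansion. If all digits are at least 2, the coefficient of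
  order \<open>k\<close> does not change after \<open>k\<close> steps, whatever series with constant coefficient 1 is put behind them; the seed 1 is one choice.
\<close>

definition qlim :: "(nat \<Rightarrow> nat) \<Rightarrow> 'a::comm_ring_1 fps" where
  "qlim c = Abs_fps (\<lambda>k. fps_nth (foldr qstep (map c [0..<k]) 1) k)"

lemma qlim_nth_0 [simp]: "fps_nth (qlim c) 0 = 1"
  by (simp add: qlim_def)

lemma qlim_congruent:
  fixes f :: "'a::comm_ring_1 fps"
  assumes "\<forall>j. c j \<ge> 2" "fps_nth f 0 = 1"
  shows "fps_X ^ Suc N dvd qlim c - foldr qstep (map c [0..<N]) f"
  unfolding fps_X_power_dvd_iff
proof (intro allI impI)
  fix i assume "i < Suc N"
  hence split: "[0..<N] = [0..<i] @ [i..<N]"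
    using upt_add_eq_append[of 0 i "N - i"] by simp
  have "fps_X ^ Suc i dvd foldr qstep (map c [0..<i]) 1 - foldr qstep (map c [0..<N]) f"
    using foldr_qstep_congruent_length[of "map c [0..<i]" 1 "foldr qstep (map c [i..<N]) f"] assms
    by (simp add: split foldr_qstep_nth_0)
  thus "fps_nth (qlim c - foldr qstep (map c [0..<N]) f) i = 0"
    by (simp add: fps_X_power_dvd_iff qlim_def del: power_Suc)
qed

lemma qlim_step:
  assumes "\<forall>j. c j \<ge> 2"
  shows "(qlim c :: 'a::comm_ring_1 fps) = qstep (c 0) (qlim (c \<circ> Suc))"
proof (rule fps_eq_if_congruent_mod_all_powers)
  fix k
  let ?g = "foldr qstep (map (c \<circ> Suc) [0..<k]) (1 :: 'a fps)"
  have "foldr qstep (map c [0..<Suc k]) 1 = qstep (c 0) ?g"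
    by (simp del: upt_Suc add: upt_conv_Cons map_Suc_upt[symmetric])
  hence "fps_X ^ Suc (Suc k) dvd (qlim c :: 'a fps) - qstep (c 0) ?g"
    using qlim_congruent[OF assms, of "1 :: 'a fps" "Suc k"] by simp
  moreover have "fps_X ^ Suc (Suc k) dvd qstep (c 0) (qlim (c \<circ> Suc)) - qstep (c 0) ?g"
    using assms by (intro qstep_congruent qlim_congruent) (auto simp: foldr_qstep_nth_0)
  ultimately have "fps_X ^ Suc (Suc k) dvd
      (qlim c - qstep (c 0) ?g) - (qstep (c 0) (qlim (c \<circ> Suc)) - qstep (c 0) ?g)"
    by (rule dvd_diff)
  hence "fps_X ^ Suc (Suc k) dvd (qlim c :: 'a fps) - qstep (c 0) (qlim (c \<circ> Suc))" by simp
  thus "fps_X ^ k dvd (qlim c :: 'a fps) - qstep (c 0) (qlim (c \<circ> Suc))"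
    by (rule dvd_trans[rotated]) (intro le_imp_power_dvd, simp)
qed

text \<open>
  Each digit is read off from the first zero coefficient of the corresponding tail.
\<close>

lemma qlim_inj:
  assumes "\<forall>j. c j \<ge> 2" "\<forall>j. d j \<ge> 2" "(qlim c :: 'a::comm_ring_1 fps) = qlim d"
  shows "c = d"
proof
  fix j show "c j = d j"
    using assms
  proof (induction j arbitrary: c d)
    case 0
    thus ?case using qstep_inj[of "c 0" "qlim (c \<circ> Suc) :: 'a fps" "d 0" "qlim (d \<circ> Suc)"]
      by (simp add: qlim_step[symmetric])
  next
    case (Suc j)
    have "(qlim (c \<circ> Suc) :: 'a fps) = qlim (d \<circ> Suc)"
      using Suc.prems qstep_inj[of "c 0" "qlim (c \<circ> Suc) :: 'a fps" "d 0" "qlim (d \<circ> Suc)"]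
      by (simp add: qlim_step[symmetric])
    from Suc.IH[OF _ _ this] Suc.prems show ?case by simp
  qed
qed

text \<open>
  The series \<open>1/(1 - q)\<close> has no zero coefficient, hence no step attains it. It is
  the image of \<open>+\<infinity>\<close>, and it marks the end of a terminating expansion.
\<close>

definition qinfty :: "'a::comm_ring_1 fps" where
  "qinfty = Abs_fps (\<lambda>_. 1)"

lemma qinfty_mult: "(1 - fps_X) * qinfty = 1"
proof (rule fps_ext)
  fix n show "fps_nth ((1 - fps_X) * qinfty) n = fps_nth (1 :: 'a fps) n"
    by (simp add: left_diff_distrib qinfty_def)
qed

lemma qinfty_nth [simp]: "fps_nth qinfty k = 1"
  by (simp add: qinfty_def)

lemma one_inv_qinfty: "one_inv qinfty = 1 - fps_X"
  by (rule one_inv_unique) (simp_all add: mult.commute[of qinfty] qinfty_mult)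

lemma qstep_neq_qinfty: "c \<ge> 1 \<Longrightarrow> qstep c f \<noteq> qinfty"
  using qstep_nth_gap[of c f] by (auto simp: qinfty_def)

lemma foldr_qstep_qinfty_inj:
  assumes "\<forall>c\<in>set cs. c \<ge> 2" "\<forall>d\<in>set ds. d \<ge> 2"
    and "foldr qstep cs (qinfty :: 'a::comm_ring_1 fps) = foldr qstep ds qinfty"
  shows "cs = ds"
  using assms
proof (induction cs arbitrary: ds)
  case Nil
  show ?case
  proof (cases ds)
    case (Cons d ds')
    with Nil have "qstep d (foldr qstep ds' qinfty) \<noteq> (qinfty :: 'a fps)"
      by (intro qstep_neq_qinfty) simp
    with Nil(3) show ?thesis unfolding Cons by simp
  qed simp
next
  case (Cons c cs)
  from Cons.prems obtain d ds' where ds: "ds = d # ds'"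
    using qstep_neq_qinfty[of c "foldr qstep cs (qinfty :: 'a fps)"] by (cases ds) simp_all
  have "c = d \<and> foldr qstep cs (qinfty :: 'a fps) = foldr qstep ds' qinfty"
    using Cons.prems unfolding ds by (intro qstep_inj) (simp_all add: foldr_qstep_nth_0)
  moreover from this have "cs = ds'"
    using Cons.prems unfolding ds by (intro Cons.IH) simp_all
  ultimately show ?case by (simp add: ds)
qed

lemma foldr_qstep_qinfty_neq_qlim:
  assumes "\<forall>c\<in>set cs. c \<ge> 2" "\<forall>j. d j \<ge> 2"
  shows "foldr qstep cs (qinfty :: 'a::comm_ring_1 fps) \<noteq> qlim d"
  using assms
proof (induction cs arbitrary: d)
  case Nil
  have "qstep (d 0) (qlim (d \<circ> Suc)) \<noteq> (qinfty :: 'a fps)"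
    using Nil(2)[rule_format, of 0] by (intro qstep_neq_qinfty) simp
  thus ?case by (simp add: qlim_step[OF Nil(2)])
next
  case (Cons c cs)
  show ?case
  proof
    assume "foldr qstep (c # cs) (qinfty :: 'a fps) = qlim d"
    hence "foldr qstep cs (qinfty :: 'a fps) = qlim (d \<circ> Suc)"
      using Cons.prems qstep_inj[of c "foldr qstep cs (qinfty :: 'a fps)" "d 0" "qlim (d \<circ> Suc)"]
      by (simp add: qlim_step[OF Cons.prems(2)] foldr_qstep_nth_0)
    moreover have "foldr qstep cs (qinfty :: 'a fps) \<noteq> qlim (d \<circ> Suc)"
      using Cons.prems by (intro Cons.IH) auto
    ultimately show False by contradiction
  qed
qed

section \<open>The q-deformations of finite and infinite expansions\<close>

lemma unit_inv_eq_one_inv: "unit_inv = one_inv"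
  by (rule ext) (simp add: unit_inv_def one_inv_def)

lemma qint_eq_sum: "qint c = (\<Sum>i<c. fps_X ^ i)"
proof -
  have "(1 - fps_X :: int fps) * one_inv (1 - fps_X) = 1" by (rule mult_one_inv) simp
  hence "(1 - fps_X) * S * one_inv (1 - fps_X) = S" for S :: "int fps"
    by (metis mult.assoc mult.commute mult.right_neutral)
  thus ?thesis by (simp add: qint_def one_diff_power_eq unit_inv_eq_one_inv)
qed

lemma qcf_append: "ds \<noteq> [] \<Longrightarrow> qcf (cs @ ds) = foldr qstep cs (qcf ds)"
proof (induction cs)
  case (Cons c cs)
  then obtain e es where "cs @ ds = e # es" by (cases "cs @ ds") auto
  with Cons show ?case by (simp add: qstep_def qint_eq_sum unit_inv_eq_one_inv)
qed simp

text \<open>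
  Since \<open>1/qinfty = 1 - q\<close>, replacing the last entry \<open>[c]_q\<close> by \<open>[c]_q - q^(c-1) (1 - q)\<close> amounts to
  one further step applied to \<open>qinfty\<close>: the point \<open>r_-\<close> is the finite expansion of \<open>r\<close> followed by
  \<open>+\<infinity>\<close>.
\<close>

lemma qcf_minus_eq_foldr: "cs \<noteq> [] \<Longrightarrow> qcf_minus cs = foldr qstep cs qinfty"
proof (induction cs rule: qcf_minus.induct)
  case (3 c d cs)
  hence "qcf_minus (d # cs) = foldr qstep (d # cs) qinfty" by simp
  thus ?case
    unfolding qcf_minus.simps foldr.simps comp_def qstep_def[of c]
    by (simp only: qint_eq_sum unit_inv_eq_one_inv)
qed (simp_all add: qstep_def qint_eq_sum unit_inv_eq_one_inv one_inv_qinfty)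

text \<open>
  A convergent is a finite composition of steps applied to its last \<open>q\<close>-integer, which has constant
  coefficient 1.
\<close>

lemma qcf_LIMSEQ_qlim:
  assumes "\<forall>j. c j \<ge> 2"
  shows "(\<lambda>N. qcf (map c [0..<Suc N])) \<longlonglongrightarrow> qlim c"
proof (rule tendsto_fpsI)
  fix k
  have "fps_nth (qcf (map c [0..<Suc N])) k = fps_nth (qlim c) k" if "N \<ge> k" for N
  proof -
    have "c N \<noteq> 0" using assms[rule_format, of N] by simp
    hence "fps_nth (qint (c N)) 0 = 1"
      by (simp add: qint_eq_sum sum_fps_X_power_nth)
    hence "fps_X ^ Suc N dvd qlim c - foldr qstep (map c [0..<N]) (qint (c N))"
      using assms by (intro qlim_congruent)
    thus ?thesis using that by (simp add: fps_X_power_dvd_iff qcf_append del: power_Suc)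
  qed
  thus "\<forall>\<^sub>F N in sequentially. fps_nth (qcf (map c [0..<Suc N])) k = fps_nth (qlim c) k"
    unfolding eventually_sequentially by blast
qed

section \<open>Reduction mod 2\<close>

lemma reduce2_nth: "fps_nth (reduce2 f) k = of_int (fps_nth f k)"
  by (simp add: reduce2_def)

lemma reduce2_mult: "reduce2 (f * g) = reduce2 f * reduce2 g"
  by (rule fps_ext) (simp add: reduce2_nth fps_mult_nth)

lemma reduce2_one: "reduce2 1 = 1"
  by (rule fps_ext) (simp add: reduce2_nth)

lemma reduce2_one_inv:
  assumes "fps_nth f 0 = 1"
  shows "reduce2 (one_inv f) = one_inv (reduce2 f)"
  by (rule one_inv_unique[symmetric])
     (simp_all add: reduce2_mult[symmetric] mult_one_inv assms reduce2_one, simp add: reduce2_nth assms)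

lemma reduce2_qstep:
  assumes "fps_nth f 0 = 1"
  shows "reduce2 (qstep c f) = qstep c (reduce2 f)"
proof (rule fps_ext)
  fix k show "fps_nth (reduce2 (qstep c f)) k = fps_nth (qstep c (reduce2 f)) k"
    by (simp add: qstep_def reduce2_nth sum_fps_X_power_nth fps_X_power_mult_nth
          reduce2_one_inv[OF assms, symmetric])
qed

lemma reduce2_foldr_qstep:
  assumes "\<forall>c\<in>set cs. c \<ge> 2" "fps_nth f 0 = 1"
  shows "reduce2 (foldr qstep cs f) = foldr qstep cs (reduce2 f)"
  using assms by (induction cs) (auto simp: reduce2_qstep foldr_qstep_nth_0)

lemma reduce2_qlim:
  assumes "\<forall>j. c j \<ge> 2"
  shows "reduce2 (qlim c) = qlim c"
proof (rule fps_ext)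
  fix k
  have "fps_nth (reduce2 (foldr qstep (map c [0..<k]) 1)) k = fps_nth (foldr qstep (map c [0..<k]) 1) k"
    using assms by (subst reduce2_foldr_qstep) (auto simp: reduce2_one)
  thus "fps_nth (reduce2 (qlim c)) k = fps_nth (qlim c) k"
    by (simp add: qlim_def reduce2_nth)
qed

lemma reduce2_qinfty: "reduce2 qinfty = qinfty"
  by (rule fps_ext) (simp add: reduce2_nth)

section \<open>Finite negative continued fractions of rationals\<close>

definition hjstep :: "nat \<Rightarrow> real \<Rightarrow> real" where
  "hjstep c x = real c - 1 / x"

lemma hj_fin_Cons: "cs \<noteq> [] \<Longrightarrow> hj_fin (c # cs) = hjstep c (hj_fin cs)"
  by (cases cs) (simp_all add: hjstep_def)

text \<open>
  The leading entry of a finite expansion is the ceiling of its value, and the expansion stops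
  exactly when the value is an integer.
\<close>

lemma hj_fin_bounds:
  assumes "\<forall>d\<in>set cs. d \<ge> 2" "c \<ge> 2"
  shows "real c - 1 < hj_fin (c # cs) \<and> hj_fin (c # cs) \<le> real c \<and>
    (hj_fin (c # cs) = real c \<longleftrightarrow> cs = [])"
  using assms
proof (induction cs arbitrary: c)
  case (Cons d cs)
  hence "hj_fin (d # cs) > 1" by fastforce
  thus ?case by (simp add: field_simps)
qed simp

lemma hj_fin_gt_1:
  assumes "\<forall>d\<in>set cs. d \<ge> 2" "cs \<noteq> []"
  shows "hj_fin cs > 1"
proof -
  from assms(2) obtain c cs' where "cs = c # cs'" by (cases cs) auto
  with assms hj_fin_bounds[of cs' c] show ?thesis by fastforce
qed

lemma ceiling_hj_fin_Cons:
  assumes "\<forall>d\<in>set cs. d \<ge> 2" "c \<ge> 2"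
  shows "\<lceil>hj_fin (c # cs)\<rceil> = int c"
  using hj_fin_bounds[OF assms] by (simp add: ceiling_eq_iff)

lemma hj_fin_inj:
  assumes "\<forall>c\<in>set cs. c \<ge> 2" "\<forall>d\<in>set ds. d \<ge> 2" "cs \<noteq> []" "ds \<noteq> []" "hj_fin cs = hj_fin ds"
  shows "cs = ds"
  using assms
proof (induction cs arbitrary: ds)
  case (Cons c cs)
  then obtain d ds' where ds: "ds = d # ds'" by (cases ds) auto
  have cd: "c = d"
    using Cons.prems ceiling_hj_fin_Cons[of cs c] ceiling_hj_fin_Cons[of ds' d]
    by (simp add: ds)
  have nil: "cs = [] \<longleftrightarrow> ds' = []"
    using Cons.prems hj_fin_bounds[of cs c] hj_fin_bounds[of ds' d] cd by (auto simp: ds)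
  show ?case
  proof (cases "cs = []")
    case False
    hence "hj_fin cs = hj_fin ds'"
      using Cons.prems(5) nil by (simp add: ds cd hj_fin_Cons hjstep_def)
    hence "cs = ds'" using Cons.prems False nil by (intro Cons.IH) (simp_all add: ds)
    thus ?thesis by (simp add: ds cd)
  qed (use nil ds cd in simp)
qed simp

text \<open>
  Division with remainder taken from above: if \<open>q\<close> does not divide \<open>p\<close>, then
  \<open>p/q = c - 1/(q/r)\<close> with \<open>c = p div q + 1\<close> and \<open>r = c q - p < q\<close>, so the denominator drops.
\<close>

lemma hj_fin_exists:
  fixes p q :: nat
  assumes "0 < q" "q < p"
  shows "\<exists>cs. cs \<noteq> [] \<and> (\<forall>c\<in>set cs. c \<ge> 2) \<and> hj_fin cs = real p / real q"
  using assms
proof (induction q arbitrary: p rule: less_induct)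
  case (less q)
  have pq: "p = q * (p div q) + p mod q" by simp
  have div: "p div q \<ge> 1" using less.prems by (simp add: Suc_le_eq div_greater_zero_iff)
  show ?case
  proof (cases "p mod q = 0")
    case True
    hence "p = q * (p div q)" by auto
    moreover from this have "p div q \<noteq> 1" using less.prems by auto
    moreover from \<open>p = q * (p div q)\<close> have "real p = real q * real (p div q)"
      by (metis of_nat_mult)
    ultimately show ?thesis
      using div less.prems by (intro exI[of _ "[p div q]"]) (auto simp: field_simps)
  next
    case False
    let ?r = "q - p mod q"
    have r: "0 < ?r" "?r < q" using False less.prems by auto
    from less.IH[OF r(2,1) r(2)] obtain cs where
      cs: "cs \<noteq> []" "\<forall>c\<in>set cs. c \<ge> 2" "hj_fin cs = real q / real ?r" by blast
    have "real p = real q * real (p div q) + real (p mod q)"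
      using pq by (metis of_nat_add of_nat_mult)
    moreover have "real ?r = real q - real (p mod q)" using less.prems by (simp add: of_nat_diff)
    moreover have "real (p div q + 1) - real ?r / real q = (real q * real (p div q) + real q - real ?r) / real q"
      using less.prems by (simp add: field_simps)
    ultimately have "hj_fin ((p div q + 1) # cs) = real p / real q"
      using cs by (simp add: hj_fin_Cons hjstep_def)
    thus ?thesis using cs div by (intro exI[of _ "(p div q + 1) # cs"]) auto
  qed
qed

lemma hj_fin_digits_eq:
  assumes "cs \<noteq> []" "\<forall>c\<in>set cs. c \<ge> 2" "hj_fin cs = of_rat r"
  shows "hj_fin_digits r = cs"
  unfolding hj_fin_digits_def using assms by (intro the_equality) (auto intro: hj_fin_inj)

lemma hj_fin_digits_correct:
  assumes "r > 1"
  shows "hj_fin_digits r \<noteq> []" "\<forall>c\<in>set (hj_fin_digits r). c \<ge> 2"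
    "hj_fin (hj_fin_digits r) = of_rat r"
proof -
  obtain a b where ab: "r = of_int a / of_int b" "b > 0" by (cases r) (auto simp: Fract_of_int_quotient)
  from assms have "1 < (of_int a / of_int b :: rat)" by (simp only: ab(1))
  hence "a > b" using ab(2) by (simp add: less_divide_eq)
  hence "of_rat r = real (nat a) / real (nat b)" using ab by (simp add: of_rat_divide)
  with hj_fin_exists[of "nat b" "nat a"] ab \<open>a > b\<close> obtain cs where
    "cs \<noteq> []" "\<forall>c\<in>set cs. c \<ge> 2" "hj_fin cs = of_rat r" by auto
  with hj_fin_digits_eq[OF this]
  show "hj_fin_digits r \<noteq> []" "\<forall>c\<in>set (hj_fin_digits r). c \<ge> 2"
    "hj_fin (hj_fin_digits r) = of_rat r" by simp_all
qed

section \<open>Infinite negative continued fractions of reals\<close>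

lemma hj_fin_append_decreasing:
  assumes "cs \<noteq> []" "\<forall>c\<in>set cs. c \<ge> 2" "d \<ge> 2"
  shows "hj_fin (cs @ [d]) \<le> hj_fin cs"
  using assms
proof (induction cs)
  case (Cons c cs)
  show ?case
  proof (cases "cs = []")
    case False
    hence "hj_fin (cs @ [d]) \<le> hj_fin cs" "hj_fin (cs @ [d]) > 1"
      using Cons by (auto intro!: hj_fin_gt_1)
    thus ?thesis using False by (simp add: hj_fin_Cons hjstep_def frac_le)
  qed (use Cons in simp)
qed simp

text \<open>
  The convergents decrease and stay above 1, so this limit exists whenever all digits are at
  least 2.
\<close>

definition hjval :: "(nat \<Rightarrow> nat) \<Rightarrow> real" where
  "hjval c = lim (\<lambda>N. hj_fin (map c [0..<Suc N]))"

lemma hj_fin_LIMSEQ_hjval: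
  assumes "\<forall>j. c j \<ge> 2"
  shows "(\<lambda>N. hj_fin (map c [0..<Suc N])) \<longlonglongrightarrow> hjval c"
proof -
  let ?h = "\<lambda>N. hj_fin (map c [0..<Suc N])"
  have "decseq ?h"
  proof (rule decseq_SucI)
    fix N show "?h (Suc N) \<le> ?h N"
      using hj_fin_append_decreasing[of "map c [0..<Suc N]" "c (Suc N)"] assms by simp
  qed
  moreover have "1 \<le> ?h N" for N
    using hj_fin_gt_1[of "map c [0..<Suc N]"] assms by simp
  ultimately obtain L where "?h \<longlonglongrightarrow> L" using decseq_convergent by blast
  thus ?thesis unfolding hjval_def by (simp add: limI)
qed

lemma hj_expansion_iff: "hj_expansion c x \<longleftrightarrow> (\<forall>j. c j \<ge> 2) \<and> x = hjval c"
  unfolding hj_expansion_def using hj_fin_LIMSEQ_hjval LIMSEQ_unique by blast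

lemma hjval_ge_1:
  assumes "\<forall>j. c j \<ge> 2"
  shows "hjval c \<ge> 1"
proof (rule LIMSEQ_le_const[OF hj_fin_LIMSEQ_hjval[OF assms]], intro exI allI impI)
  fix N show "1 \<le> hj_fin (map c [0..<Suc N])"
    using hj_fin_gt_1[of "map c [0..<Suc N]"] assms by simp
qed

lemma hjval_step:
  assumes "\<forall>j. c j \<ge> 2"
  shows "hjval c = hjstep (c 0) (hjval (c \<circ> Suc))"
proof -
  have tail: "\<forall>j. (c \<circ> Suc) j \<ge> 2" using assms by simp
  have eq: "hj_fin (map c [0..<Suc (Suc N)]) = hjstep (c 0) (hj_fin (map (c \<circ> Suc) [0..<Suc N]))" for N
  proof -
    have "map c [0..<Suc (Suc N)] = c 0 # map (c \<circ> Suc) [0..<Suc N]"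
      by (simp del: upt_Suc add: upt_conv_Cons map_Suc_upt[symmetric])
    thus ?thesis by (simp only: hj_fin_Cons map_is_Nil_conv upt_eq_Nil_conv) (simp add: hj_fin_Cons)
  qed
  have "(\<lambda>N. hjstep (c 0) (hj_fin (map (c \<circ> Suc) [0..<Suc N]))) \<longlonglongrightarrow> hjstep (c 0) (hjval (c \<circ> Suc))"
  proof -
    have "hjval (c \<circ> Suc) \<noteq> 0" using hjval_ge_1[OF tail] by linarith
    thus ?thesis unfolding hjstep_def by (intro tendsto_intros hj_fin_LIMSEQ_hjval tail)
  qed
  moreover have "(\<lambda>N. hjstep (c 0) (hj_fin (map (c \<circ> Suc) [0..<Suc N]))) \<longlonglongrightarrow> hjval c"
    unfolding eq[symmetric] by (rule LIMSEQ_Suc[OF hj_fin_LIMSEQ_hjval[OF assms]])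
  ultimately show ?thesis using LIMSEQ_unique by blast
qed

text \<open>
  For \<open>y \<ge> 1\<close> the value of a step lies in \<open>[c - 1, c)\<close>. Digits of infinite expansions are therefore
  governed by the floor, whereas those of finite expansions are governed by the ceiling.
\<close>

lemma hjstep_eq_floor:
  assumes "x = hjstep c y" "y \<ge> 1"
  shows "\<lfloor>x\<rfloor> = int c - 1" and "y = 1 / (real c - x)"
proof -
  have "0 < 1 / y" "1 / y \<le> 1" using assms(2) by (auto simp: field_simps)
  thus "\<lfloor>x\<rfloor> = int c - 1" using assms(1) by (simp add: floor_eq_iff hjstep_def)
  show "y = 1 / (real c - x)" using assms by (simp add: hjstep_def)
qed

lemma hjval_inj:
  assumes "\<forall>j. c j \<ge> 2" "\<forall>j. d j \<ge> 2" "hjval c = hjval d"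
  shows "c = d"
proof
  fix j show "c j = d j"
    using assms
  proof (induction j arbitrary: c d)
    case 0
    thus ?case
      using hjstep_eq_floor(1)[OF hjval_step[of c]] hjstep_eq_floor(1)[OF hjval_step[of d]]
      by (simp add: hjval_ge_1)
  next
    case (Suc j)
    have "c 0 = d 0"
      using hjstep_eq_floor(1)[OF hjval_step[of c]] hjstep_eq_floor(1)[OF hjval_step[of d]] Suc.prems
      by (simp add: hjval_ge_1)
    hence "hjval (c \<circ> Suc) = hjval (d \<circ> Suc)"
      using hjstep_eq_floor(2)[OF hjval_step[of c]] hjstep_eq_floor(2)[OF hjval_step[of d]] Suc.prems
      by (simp add: hjval_ge_1)
    from Suc.IH[OF _ _ this] Suc.prems show ?case by simp
  qed
qed

lemma hj_digits_hjval: "\<forall>j. c j \<ge> 2 \<Longrightarrow> hj_digits (hjval c) = c"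
  unfolding hj_digits_def by (rule the_equality) (auto simp: hj_expansion_iff intro: hjval_inj)

text \<open>
  If two such sequences started with \<open>X 0 < Y 0\<close>, then from
  \<open>Y (j+1) - X (j+1) = X (j+1) Y (j+1) (Y j - X j)\<close> the differences would not decrease, which
  keeps \<open>Y\<close> away from 1 and hence forces exponential growth. But corresponding terms have the same
  floor, so the differences stay below 1.
\<close>

lemma hjstep_tails_unique:
  fixes X Y :: "nat \<Rightarrow> real"
  assumes X: "\<And>j. X j \<ge> 1" "\<And>j. X j = hjstep (c j) (X (Suc j))"
    and Y: "\<And>j. Y j \<ge> 1" "\<And>j. Y j = hjstep (c j) (Y (Suc j))"
  shows "X 0 = Y 0"
proof -
  have "\<not> X 0 < Y 0"
    if X: "\<And>j. X j \<ge> 1" "\<And>j. X j = hjstep (c j) (X (Suc j))"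
    and Y: "\<And>j. Y j \<ge> 1" "\<And>j. Y j = hjstep (c j) (Y (Suc j))" for X Y :: "nat \<Rightarrow> real"
  proof
    assume less: "X 0 < Y 0"
    define d where "d = Y 0 - X 0"
    have d: "d > 0" using less by (simp add: d_def)
    have grow: "d * (1 + d) ^ n \<le> Y n - X n" for n
    proof (induction n)
      case (Suc n)
      let ?x = "X (Suc n)" and ?y = "Y (Suc n)"
      have x: "?x \<ge> 1" and y: "?y \<ge> 1" by (rule X(1), rule Y(1))
      have "Y n - X n = 1 / ?x - 1 / ?y"
        by (subst X(2), subst Y(2)) (simp add: hjstep_def)
      hence diff: "?y - ?x = ?x * ?y * (Y n - X n)" using x y by (simp add: field_simps)
      have "d * 1 \<le> d * (1 + d) ^ n" using d by (intro mult_left_mono) auto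
      hence dn: "d \<le> Y n - X n" using Suc by simp
      have "1 * 1 * (Y n - X n) \<le> ?x * ?y * (Y n - X n)"
        using x y dn d by (intro mult_mono) auto
      hence "1 + d \<le> ?y" using diff dn x by simp
      hence "1 * (1 + d) * (d * (1 + d) ^ n) \<le> ?x * ?y * (Y n - X n)"
        using x d Suc by (intro mult_mono) auto
      thus ?case using diff by (simp add: algebra_simps)
    qed (simp add: d_def)
    obtain n where "1 / d < (1 + d) ^ n" using d real_arch_pow[of "1 + d" "1 / d"] by auto
    hence "1 < Y n - X n" using grow[of n] d by (simp add: field_simps)
    moreover have "\<lfloor>X n\<rfloor> = \<lfloor>Y n\<rfloor>"
      using hjstep_eq_floor(1)[OF X(2) X(1)] hjstep_eq_floor(1)[OF Y(2) Y(1)] by simp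
    ultimately show False by linarith
  qed
  from this[OF X Y] this[OF Y X] show ?thesis by simp
qed

lemma hjval_eqI:
  assumes c: "\<forall>j. c j \<ge> 2" and X: "\<And>j. X j \<ge> 1" "\<And>j. X j = hjstep (c j) (X (Suc j))"
  shows "hjval c = X 0"
proof -
  have "hjval (\<lambda>i. c (i + j)) = hjstep (c j) (hjval (\<lambda>i. c (i + Suc j)))" for j
    using hjval_step[of "\<lambda>i. c (i + j)"] c by (simp add: comp_def)
  moreover have "hjval (\<lambda>i. c (i + j)) \<ge> 1" for j
    using c by (intro hjval_ge_1) simp
  ultimately show ?thesis
    using hjstep_tails_unique[where X = "\<lambda>j. hjval (\<lambda>i. c (i + j))" and Y = X and c = c, OF _ _ X]
    by simp
qed

text \<open>
  The digits come from iterating \<open>x \<mapsto> 1/(floor x + 1 - x)\<close>, which preserves \<open>[1, \<infinity>)\<close>; the iterates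
  are the tails that identify \<open>x\<close> as the value of the expansion.
\<close>

lemma hjval_hj_digits:
  assumes "x \<ge> 1"
  shows "\<forall>j. hj_digits x j \<ge> 2" "hjval (hj_digits x) = x"
proof -
  define X where "X n = ((\<lambda>x. 1 / (of_int \<lfloor>x\<rfloor> + 1 - x)) ^^ n) x" for n
  define c where "c n = nat (\<lfloor>X n\<rfloor> + 1)" for n
  have X1: "X n \<ge> 1" for n
  proof (induction n)
    case (Suc n)
    have "0 < of_int \<lfloor>X n\<rfloor> + 1 - X n" "of_int \<lfloor>X n\<rfloor> + 1 - X n \<le> 1" by linarith+
    thus ?case by (simp add: X_def[of "Suc n"] X_def[of n, symmetric])
  qed (use assms in \<open>simp add: X_def\<close>)
  have fl: "\<lfloor>X n\<rfloor> \<ge> 1" for n using X1[of n] by simp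
  have c: "\<forall>n. c n \<ge> 2"
  proof
    fix n show "c n \<ge> 2" using fl[of n] by (simp only: c_def le_nat_iff)
  qed
  have "X n = hjstep (c n) (X (Suc n))" for n
  proof -
    have "real (c n) = of_int \<lfloor>X n\<rfloor> + 1" using fl[of n] by (simp add: c_def)
    thus ?thesis by (simp add: hjstep_def X_def[of "Suc n"] X_def[of n, symmetric])
  qed
  from hjval_eqI[OF c X1 this] have "hjval c = x" by (simp add: X_def)
  with hj_digits_hjval[OF c] c show "\<forall>j. hj_digits x j \<ge> 2" "hjval (hj_digits x) = x" by auto
qed

section \<open>Periodic expansions\<close>

lemma ev_periodic_Cons_0: "ev_periodic (a # pre) per 0 = a"
  by (simp add: ev_periodic_def)

lemma ev_periodic_Cons_Suc: "ev_periodic (a # pre) per \<circ> Suc = ev_periodic pre per"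
  by (rule ext) (simp add: ev_periodic_def)

text \<open>
  Moving one period into the preperiod; this is how the fixed-point equation of a purely periodic
  expansion arises.
\<close>

lemma ev_periodic_unroll: "per \<noteq> [] \<Longrightarrow> ev_periodic [] per = ev_periodic per per"
  by (rule ext) (simp add: ev_periodic_def le_mod_geq)

lemma ev_periodic_ge:
  assumes "\<forall>c\<in>set pre. c \<ge> m" "\<forall>c\<in>set per. c \<ge> m" "per \<noteq> []"
  shows "\<forall>j. ev_periodic pre per j \<ge> m"
  using assms by (auto simp: ev_periodic_def)

lemma hjval_ev_periodic:
  assumes "\<forall>c\<in>set cs. c \<ge> 2" "\<forall>c\<in>set pre. c \<ge> 2" "\<forall>c\<in>set per. c \<ge> 2" "per \<noteq> []"
  shows "hjval (ev_periodic (cs @ pre) per) = foldr hjstep cs (hjval (ev_periodic pre per))"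
  using assms
proof (induction cs)
  case (Cons c cs)
  have "hjval (ev_periodic (c # (cs @ pre)) per) = hjstep c (hjval (ev_periodic (cs @ pre) per))"
    using hjval_step[OF ev_periodic_ge, of "c # (cs @ pre)" per] Cons.prems
    by (auto simp: ev_periodic_Cons_0 ev_periodic_Cons_Suc)
  with Cons show ?case by simp
qed simp

section \<open>The quadratic equation\<close>

text \<open>
  The real counterpart of the computation for runs of twos: here the two fixed points of
  \<open>x \<mapsto> 2 - 1/x\<close> coincide at 1, and \<open>1/(x - 1)\<close> is translated by 1 instead of being scaled.
\<close>

lemma foldr_hjstep_twos:
  assumes "x > 1"
  shows "foldr hjstep (replicate k 2) x > 1 \<and>
    1 / (foldr hjstep (replicate k 2) x - 1) = real k + 1 / (x - 1)"
proof (induction k)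
  case (Suc k)
  let ?y = "foldr hjstep (replicate k 2) x"
  have y: "?y > 1" using Suc by blast
  have "hjstep 2 ?y - 1 = (?y - 1) / ?y" using y by (simp add: hjstep_def field_simps)
  moreover have "1 / ((?y - 1) / ?y) = 1 + 1 / (?y - 1)" using y by (simp add: field_simps)
  moreover have "hjstep 2 ?y > 1" using y by (simp add: hjstep_def)
  ultimately show ?case using Suc by simp
qed (use assms in simp)

text \<open>
  In the coordinate \<open>1/(x - 1)\<close> runs of twos are translations, so the fixed-point equation of the
  period becomes a quadratic equation. Passing to \<open>W\<close>, which includes the two preperiodic twos, makes
  it reciprocal.
\<close>

lemma hjstep_surd_period:
  fixes m :: nat and z :: real
  assumes "z \<ge> 1" and z: "foldr hjstep (replicate m 2 @ [4] @ replicate m 2 @ [3]) z = z"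
  defines "W \<equiv> 2 + 1 / (z - 1)"
  shows "z > 1" and "(2 * real m + 5) * (W\<^sup>2 + 1) = 2 * (real m ^ 2 + 5 * real m + 7) * W"
proof -
  define f3 where "f3 = hjstep 3 z"
  define f2 where "f2 = foldr hjstep (replicate m 2) f3"
  define f1 where "f1 = hjstep 4 f2"
  have zf: "z = foldr hjstep (replicate m 2) f1"
    using z by (simp add: f1_def f2_def f3_def)
  have f3: "f3 > 1" using \<open>z \<ge> 1\<close> by (simp add: f3_def hjstep_def field_simps)
  note v2 = foldr_hjstep_twos[OF f3, of m, folded f2_def]
  have f1: "f1 > 1" using v2 by (simp add: f1_def hjstep_def field_simps)
  note v1 = foldr_hjstep_twos[OF f1, of m, folded zf]
  show "z > 1" using v1 by blast
  \<comment> \<open>The coordinate \<open>1/(x - 1)\<close> at \<open>z\<close> and at the tail that follows the digit 4.\<close>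
  define w where "w = 1 / (z - 1)"
  have w: "w > 0" and zw: "z = 1 + 1 / w" using \<open>z > 1\<close> by (auto simp: w_def)
  define v where "v = 1 / (f2 - 1)"
  have v: "v > 0" and fv: "f2 = 1 + 1 / v"
    using conjunct1[OF v2] by (auto simp: v_def)
  have "f3 - 1 = (w + 2) / (w + 1)"
    using w by (simp add: f3_def zw hjstep_def field_simps)
  hence vw: "v = m + (w + 1) / (w + 2)" using v2 by (simp add: v_def)
  have "f1 - 1 = (2 * v + 3) / (v + 1)"
    using v by (simp add: f1_def fv hjstep_def field_simps)
  hence wv: "w = m + (v + 1) / (2 * v + 3)" using v1 by (simp add: w_def)
  have a: "(v - m) * (w + 2) = w + 1" using vw w by (simp add: field_simps)
  have b: "(w - m) * (2 * v + 3) = v + 1" using wv v by (simp add: field_simps)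
  have "(w - m) * (2 * v * (w + 2) + 3 * (w + 2)) = v * (w + 2) + (w + 2)"
    using arg_cong[OF b, of "\<lambda>t. t * (w + 2)"] by (simp add: algebra_simps)
  moreover have vv: "v * (w + 2) = w + 1 + m * (w + 2)" using a by (simp add: algebra_simps)
  ultimately have "(w - m) * (2 * (w + 1 + m * (w + 2)) + 3 * (w + 2)) = w + 1 + m * (w + 2) + (w + 2)"
    by (simp only: mult.assoc)
  moreover have "W = w + 2" by (simp add: W_def w_def)
  ultimately show "(2 * real m + 5) * (W\<^sup>2 + 1) = 2 * (real m ^ 2 + 5 * real m + 7) * W"
    by (simp add: algebra_simps power2_eq_square)
qed

text \<open>
  The roots have product 1, so exactly one of them lies in \<open>(0, 1)\<close>, namely the smaller one.
\<close>

lemma reciprocal_quadratic_solution: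
  fixes a b y :: real
  assumes "0 < y" "y < 1" "a > 0" "a * (y\<^sup>2 + 1) = 2 * b * y"
  shows "y = (b - sqrt (b\<^sup>2 - a\<^sup>2)) / a"
proof -
  have "(b - a * y)\<^sup>2 = b\<^sup>2 - a\<^sup>2"
    using arg_cong[OF assms(4), of "\<lambda>t. a * t"] by (simp add: algebra_simps power2_eq_square)
  moreover have "b - a * y \<ge> 0"
  proof -
    have "0 \<le> a * (1 - y\<^sup>2)" using assms by (simp add: power_le_one_iff abs_le_square_iff)
    hence "2 * y * (a * y) \<le> 2 * y * b" using assms(4) by (simp add: algebra_simps power2_eq_square)
    thus ?thesis using assms(1) by simp
  qed
  ultimately have "sqrt (b\<^sup>2 - a\<^sup>2) = b - a * y" by (metis real_sqrt_abs abs_of_nonneg)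
  thus ?thesis using assms(3) by simp
qed

lemma sqrt_irrational_between_squares:
  fixes D k :: nat
  assumes "k\<^sup>2 < D" "D < (k + 1)\<^sup>2"
  shows "sqrt (real D) \<notin> \<rat>"
proof
  assume "sqrt (real D) \<in> \<rat>"
  then obtain p q :: nat where pq: "q \<noteq> 0" "\<bar>sqrt (real D)\<bar> = real p / real q" "coprime p q"
    by (rule Rats_abs_nat_div_natE)
  hence "real p = sqrt (real D) * real q" by (simp add: field_simps)
  hence "real (p\<^sup>2) = real (D * q\<^sup>2)" by (simp add: power_mult_distrib)
  hence eq: "p\<^sup>2 = D * q\<^sup>2" by (simp only: of_nat_eq_iff)
  hence "q dvd p\<^sup>2" by simp
  moreover have "coprime q (p\<^sup>2)" using pq(3) by (simp add: coprime_commute)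
  ultimately have "q = 1" using coprime_absorb_left[of q "p\<^sup>2"] by simp
  hence "p\<^sup>2 = D" using eq by simp
  hence "k < p" "p < k + 1" using assms by (auto intro: power_less_imp_less_base[of _ 2])
  thus False by simp
qed

section \<open>Injectivity on the Cantor line\<close>

lemma qreal_eq_qlim: "x \<ge> 1 \<Longrightarrow> qreal x = qlim (hj_digits x)"
  unfolding qreal_def by (intro limI qcf_LIMSEQ_qlim hjval_hj_digits)

lemma reduce2_qreal: "x \<ge> 1 \<Longrightarrow> reduce2 (qreal x) = qlim (hj_digits x)"
  by (simp add: qreal_eq_qlim reduce2_qlim hjval_hj_digits)

lemma reduce2_qrat_minus: "r > 1 \<Longrightarrow> reduce2 (qrat_minus r) = foldr qstep (hj_fin_digits r) qinfty"
  by (simp add: qrat_minus_def qcf_minus_eq_foldr hj_fin_digits_correct reduce2_foldr_qstep reduce2_qinfty)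

lemma Phi2_PInf: "Phi2 PInf = qinfty"
  unfolding Phi2.simps by (rule fps_inverse_unique) (rule qinfty_mult)

lemma cantor_line1_simps:
  "Irr x \<in> cantor_line1 \<longleftrightarrow> x \<notin> \<rat> \<and> x > 1"
  "RPlus r \<in> cantor_line1 \<longleftrightarrow> r \<ge> 1"
  "RMinus r \<in> cantor_line1 \<longleftrightarrow> r > 1"
  "PInf \<in> cantor_line1"
  "MInf \<notin> cantor_line1"
  by (auto simp: cantor_line1_def cantor_line_def cantor_le_def)

text \<open>
  Every point is encoded by a terminating or an infinite digit sequence from which it can be
  recovered. Terminating sequences give the points \<open>r_-\<close> and, when empty, \<open>+\<infinity>\<close>; infinite ones give
  the irrationals and the points \<open>r_+\<close>, told apart by the rationality of the real value. The
  definite descriptions exhibit the point as a function of its digits.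
\<close>

lemma cantor_line1_cases:
  assumes "a \<in> cantor_line1"
  obtains (fin) cs where "\<forall>c\<in>set cs. c \<ge> 2" "Phi2 a = foldr qstep cs qinfty"
      "a = (if cs = [] then PInf else RMinus (THE r. hj_fin cs = of_rat r))"
  | (inf) c where "\<forall>j. c j \<ge> 2" "Phi2 a = qlim c"
      "a = (if hjval c \<in> \<rat> then RPlus (THE r. hjval c = of_rat r) else Irr (hjval c))"
proof (cases a)
  case (Irr x)
  with assms inf[of "hj_digits x"] show ?thesis
    by (simp add: cantor_line1_simps reduce2_qreal hjval_hj_digits)
next
  case (RPlus r)
  hence "(of_rat r :: real) \<ge> 1" using assms by (simp add: cantor_line1_simps)
  with RPlus inf[of "hj_digits (of_rat r)"] show ?thesis
    by (simp add: reduce2_qreal hjval_hj_digits)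
next
  case (RMinus r)
  with assms have "r > 1" by (simp add: cantor_line1_simps)
  with RMinus fin[of "hj_fin_digits r"] show ?thesis
    by (simp add: reduce2_qrat_minus hj_fin_digits_correct)
next
  case PInf
  thus ?thesis using fin[of "[]"] Phi2_PInf by simp
qed (use assms in \<open>simp add: cantor_line1_simps\<close>)

text \<open>
  The digit sequence of a point can be read off from its series, and it determines the point.
\<close>

lemma Phi2_inj: "inj_on Phi2 cantor_line1"
proof (rule inj_onI)
  fix a b assume "a \<in> cantor_line1" "b \<in> cantor_line1" and eq: "Phi2 a = Phi2 b"
  from this(1) show "a = b"
  proof (cases rule: cantor_line1_cases)
    case (fin cs)
    note a = this
    from \<open>b \<in> cantor_line1\<close> show ?thesis
    proof (cases rule: cantor_line1_cases)
      case (fin ds)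
      hence "cs = ds" using a eq by (intro foldr_qstep_qinfty_inj[where 'a = bit]) simp_all
      thus ?thesis using a fin by simp
    next
      case (inf d)
      thus ?thesis using a eq foldr_qstep_qinfty_neq_qlim[where 'a = bit] by metis
    qed
  next
    case (inf c)
    note a = this
    from \<open>b \<in> cantor_line1\<close> show ?thesis
    proof (cases rule: cantor_line1_cases)
      case (fin ds)
      thus ?thesis using a eq foldr_qstep_qinfty_neq_qlim[where 'a = bit] by metis
    next
      case (inf d)
      hence "c = d" using a eq by (intro qlim_inj[where 'a = bit]) simp_all
      thus ?thesis using a inf by simp
    qed
  qed
qed

lemma Phi2_nth_0:
  assumes "a \<in> cantor_line1"
  shows "fps_nth (Phi2 a) 0 = 1"
  using assms by (cases rule: cantor_line1_cases) (simp_all add: foldr_qstep_nth_0)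

lemma xpt_eqI:
  assumes "a \<in> cantor_line1" "Phi2 a = 1 + fps_X ^ n"
  shows "xpt n = a"
  unfolding xpt_def assms(2)[symmetric] by (rule inv_into_f_f[OF Phi2_inj assms(1)])

lemma Phi2_hjval:
  assumes "\<forall>j. c j \<ge> 2"
  shows "hjval c \<notin> \<rat> \<Longrightarrow> Phi2 (Irr (hjval c)) = qlim c"
    and "hjval c = of_rat r \<Longrightarrow> Phi2 (RPlus r) = qlim c"
  using reduce2_qreal[OF hjval_ge_1[OF assms]] hj_digits_hjval[OF assms] by simp_all

lemma qlim_ev_periodic:
  assumes "\<forall>c\<in>set cs. c \<ge> 2" "\<forall>c\<in>set pre. c \<ge> 2" "\<forall>c\<in>set per. c \<ge> 2" "per \<noteq> []"
  shows "(qlim (ev_periodic (cs @ pre) per) :: 'a::comm_ring_1 fps) =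
    foldr qstep cs (qlim (ev_periodic pre per))"
  using assms
proof (induction cs)
  case (Cons c cs)
  have "(qlim (ev_periodic (c # (cs @ pre)) per) :: 'a fps) = qstep c (qlim (ev_periodic (cs @ pre) per))"
    using qlim_step[OF ev_periodic_ge, of "c # (cs @ pre)" per] Cons.prems
    by (auto simp: ev_periodic_Cons_0 ev_periodic_Cons_Suc)
  with Cons show ?case by simp
qed simp

text \<open>
  The value of a purely periodic expansion is the unique fixed point of the composition over one
  period.
\<close>

lemma qlim_periodic_eqI:
  fixes f :: "'a::comm_ring_1 fps"
  assumes "per \<noteq> []" "\<forall>c\<in>set per. c \<ge> 2" "fps_nth f 0 = 1" "foldr qstep per f = f"
  shows "qlim (ev_periodic [] per) = f"
proof (rule foldr_qstep_fixed_point_unique[OF assms(1,2) qlim_nth_0 assms(3) _ assms(4)])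
  show "foldr qstep per (qlim (ev_periodic [] per)) = (qlim (ev_periodic [] per) :: 'a fps)"
  proof -
    have "qlim (ev_periodic (per @ []) per) = (foldr qstep per (qlim (ev_periodic [] per)) :: 'a fps)"
      using assms(1,2) by (intro qlim_ev_periodic) simp_all
    from this[unfolded append_Nil2 ev_periodic_unroll[OF assms(1), symmetric]] show ?thesis
      by (rule sym)
  qed
qed

section \<open>Computing steps with fractions\<close>

lemma qstep_eqI:
  fixes f g :: "'a::comm_ring_1 fps"
  assumes "fps_nth f 0 = 1" "g * f = (\<Sum>i<c. fps_X ^ i) * f - fps_X ^ (c - 1)"
  shows "qstep c f = g"
proof -
  have "g = (g * f) * one_inv f" using assms(1) by (simp add: mult_one_inv mult.assoc)
  also have "\<dots> = (\<Sum>i<c. fps_X ^ i) * (f * one_inv f) - fps_X ^ (c - 1) * one_inv f"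
    by (simp only: assms(2) left_diff_distrib mult.assoc)
  finally show ?thesis by (simp add: qstep_def mult_one_inv assms(1))
qed

lemma qstep_2: "qstep 2 f = 1 + fps_X - fps_X * one_inv f"
  by (simp add: qstep_def numeral_2_eq_2)

lemma qstep_2_one: "qstep 2 1 = 1"
  by (rule qstep_eqI) (simp_all add: numeral_2_eq_2)

lemma qstep_3_one: "qstep 3 1 = 1 + fps_X"
  by (rule qstep_eqI) (simp_all add: numeral_3_eq_3)

text \<open>
  The map \<open>qstep 2\<close> is a Moebius transformation with fixed points \<open>1\<close> and \<open>q\<close>, and it multiplies
  \<open>(f - 1)/(f - q)\<close> by \<open>q\<close>. So \<open>k\<close> steps multiply this quantity by \<open>q^k\<close>, which makes long runs
  of the digit 2 computable at once.
\<close>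

lemma foldr_qstep_twos_eqI:
  fixes f g :: "'a::comm_ring_1 fps"
  assumes "fps_nth f 0 = 1" "fps_nth g 0 = 1"
    and "(g - 1) * (f - fps_X) = fps_X ^ k * (f - 1) * (g - fps_X)"
  shows "foldr qstep (replicate k 2) f = g"
proof -
  let ?T = "\<lambda>k. foldr qstep (replicate k 2) f"
  have T0: "fps_nth (?T k) 0 = 1" for k
    using assms(1) by (intro foldr_qstep_nth_0) auto
  have T: "(?T k - 1) * (f - fps_X) = fps_X ^ k * (f - 1) * (?T k - fps_X)" for k
  proof (induction k)
    case (Suc k)
    have h: "?T k * one_inv (?T k) = 1" by (rule mult_one_inv[OF T0])
    have step: "?T (Suc k) = 1 + fps_X - fps_X * one_inv (?T k)"
      by (simp add: qstep_2)
    have "?T (Suc k) - 1 = fps_X * one_inv (?T k) * (?T k - 1)"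
      unfolding step using h by (simp add: algebra_simps)
    moreover have "?T (Suc k) - fps_X = one_inv (?T k) * (?T k - fps_X)"
      unfolding step using h by (simp add: algebra_simps)
    ultimately show ?case
      using arg_cong[OF Suc, of "\<lambda>h. fps_X * one_inv (?T k) * h"] by (simp add: mult_ac)
  qed simp
  \<comment> \<open>Both candidates solve one linear equation whose coefficient \<open>u\<close> is invertible.\<close>
  define u where "u = (f - fps_X) - fps_X ^ k * (f - 1)"
  have "u * h = (f - fps_X) - fps_X ^ k * (f - 1) * fps_X"
    if "(h - 1) * (f - fps_X) = fps_X ^ k * (f - 1) * (h - fps_X)" for h
    using that by (simp add: u_def algebra_simps)
  from this[OF T] this[OF assms(3)] have "u * ?T k = u * g" by simp
  moreover have "one_inv u * (u * h) = h" for h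
  proof -
    have "one_inv u * (u * h) = (u * one_inv u) * h" by (simp only: mult_ac)
    moreover have "fps_nth u 0 = 1" using assms(1) by (simp add: u_def)
    ultimately show ?thesis by (simp only: mult_one_inv mult_1_left)
  qed
  ultimately show ?thesis by metis
qed

definition qfrac :: "'a::comm_ring_1 fps \<Rightarrow> 'a fps \<Rightarrow> 'a fps" where
  "qfrac a b = a * one_inv b"

lemma qfrac_nth_0: "fps_nth (qfrac a b) 0 = fps_nth a 0"
  by (simp add: qfrac_def)

lemma qfrac_1: "qfrac a 1 = a"
  using mult_one_inv[of "1 :: 'a::comm_ring_1 fps"] by (simp add: qfrac_def)

lemma qstep_frac:
  assumes "fps_nth a 0 = 1" "fps_nth b 0 = 1" "fps_nth b' 0 = 1"
    and "a' * a = b' * ((\<Sum>i<c. fps_X ^ i) * a - fps_X ^ (c - 1) * b)"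
  shows "qstep c (qfrac a b) = qfrac a' b'"
proof (rule qstep_eqI)
  let ?S = "\<Sum>i<c. fps_X ^ i :: 'a fps"
  have "qfrac a' b' * qfrac a b = one_inv b' * one_inv b * (a' * a)"
    by (simp add: qfrac_def mult_ac)
  also have "\<dots> = (b' * one_inv b') * (?S * (a * one_inv b) - fps_X ^ (c - 1) * (b * one_inv b))"
    unfolding assms(4) by (simp add: algebra_simps)
  finally show "qfrac a' b' * qfrac a b = ?S * qfrac a b - fps_X ^ (c - 1)"
    by (simp add: qfrac_def mult_one_inv assms(2,3))
qed (simp add: qfrac_nth_0 assms(1))

lemma foldr_qstep_twos_frac:
  assumes "fps_nth a 0 = 1" "fps_nth b 0 = 1" "fps_nth a' 0 = 1" "fps_nth b' 0 = 1"
    and "(a' - b') * (a - fps_X * b) = fps_X ^ k * (a - b) * (a' - fps_X * b')"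
  shows "foldr qstep (replicate k 2) (qfrac a b) = qfrac a' b'"
proof (rule foldr_qstep_twos_eqI)
  have 1: "qfrac c d - 1 = one_inv d * (c - d)" "qfrac c d - fps_X = one_inv d * (c - fps_X * d)"
    if "fps_nth d 0 = 1" for c d :: "'a fps"
    using mult_one_inv[OF that] by (simp_all add: qfrac_def algebra_simps)
  show "(qfrac a' b' - 1) * (qfrac a b - fps_X) = fps_X ^ k * (qfrac a b - 1) * (qfrac a' b' - fps_X)"
    using arg_cong[OF assms(5), of "\<lambda>h. one_inv b * one_inv b' * h"]
    unfolding 1[OF assms(2)] 1[OF assms(4)] by (simp only: mult_ac)
qed (simp_all add: qfrac_nth_0 assms)

section \<open>The periodic expansion of the series with one monomial\<close>

lemma fps_bit_2_eq_0: "(2 :: bit fps) = 0"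
  by (rule fps_ext) (simp add: fps_numeral_nth)

lemma fps_bit_add_self: "f + f = (0 :: bit fps)"
  by (simp only: mult_2[symmetric] fps_bit_2_eq_0 mult_zero_left)

lemma fps_bit_add_left_self: "f + (f + g) = (g :: bit fps)"
  by (simp only: add.assoc[symmetric] fps_bit_add_self add_0)

lemma fps_bit_diff: "f - g = (f + g :: bit fps)"
  by (rule fps_ext) simp

lemmas fps_bit_ring_simps =
  fps_bit_diff algebra_simps power2_eq_square power3_eq_cube fps_bit_2_eq_0 fps_bit_add_self
  fps_bit_add_left_self

text \<open>
  With \<open>p = q^m\<close>, where \<open>m = n - 3\<close>, the four stages of the period pass through the fractions
  \<open>z\<close>, then \<open>(1 + q + q\<^sup>2 p)/(1 + q\<^sup>2 p)\<close> after the digit 3, then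
  \<open>(1 + q^3 p)/(1 + q p + q\<^sup>2 p + q^3 p)\<close> after a run of twos, then
  \<open>(1 + q + q\<^sup>2 + q^3 p)/(1 + q^3 p)\<close> after the digit 4, and back to \<open>z\<close>. They are found by expanding
  \<open>1 + q^n\<close> from the front. The steps with digits 3 and 4 are identities over any ring; the passage
  through the runs of twos uses characteristic 2, through \<open>1 + q\<^sup>2 = (1 + q)\<^sup>2\<close> and similar factorizations.
\<close>

lemma period_mod_2:
  fixes m :: nat
  defines "q \<equiv> fps_X :: bit fps" and "p \<equiv> (fps_X :: bit fps) ^ m"
  defines "z \<equiv> qfrac (1 + q\<^sup>2 * p) (1 + q * p + q\<^sup>2 * p)"
  shows "foldr qstep (replicate m 2 @ [4] @ replicate m 2 @ [3]) z = z"
    and "foldr qstep [2, 2] z = 1 + q ^ 3 * p"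
    and "fps_nth z 0 = 1"
proof -
  have q0: "fps_nth (q * h) 0 = 0" "fps_nth (q ^ 2 * h) 0 = 0" "fps_nth (q ^ 3 * h) 0 = 0"
    "fps_nth q 0 = 0" "fps_nth (q ^ 2) 0 = 0" for h
    by (simp_all add: q_def power2_eq_square power3_eq_cube mult.assoc)
  have qm: "q ^ m = p" by (simp add: q_def p_def)
  have sum3: "(\<Sum>i<3. q ^ i) = 1 + q + q ^ 2"
    by (simp add: q_def numeral_3_eq_3 power2_eq_square)
  have sum4: "(\<Sum>i<4. q ^ i) = 1 + q + q ^ 2 + q ^ 3"
    by (simp add: q_def eval_nat_numeral)
  have s3: "qstep 3 z = qfrac (1 + q + q\<^sup>2 * p) (1 + q\<^sup>2 * p)"
    unfolding z_def by (rule qstep_frac) (simp_all add: q0 sum3 q_def[symmetric] fps_bit_ring_simps)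
  have t3: "foldr qstep (replicate m 2) (qfrac (1 + q + q\<^sup>2 * p) (1 + q\<^sup>2 * p)) =
      qfrac (1 + q ^ 3 * p) (1 + q * p + q\<^sup>2 * p + q ^ 3 * p)"
    by (rule foldr_qstep_twos_frac)
       (simp_all add: q0 q_def[symmetric] qm fps_bit_ring_simps)
  have s4: "qstep 4 (qfrac (1 + q ^ 3 * p) (1 + q * p + q\<^sup>2 * p + q ^ 3 * p)) =
      qfrac (1 + q + q\<^sup>2 + q ^ 3 * p) (1 + q ^ 3 * p)"
    by (rule qstep_frac) (simp_all add: q0 sum4 q_def[symmetric] fps_bit_ring_simps)
  have t4: "foldr qstep (replicate m 2) (qfrac (1 + q + q\<^sup>2 + q ^ 3 * p) (1 + q ^ 3 * p)) = z"
    unfolding z_def by (rule foldr_qstep_twos_frac)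
       (simp_all add: q0 q_def[symmetric] qm fps_bit_ring_simps)
  show "foldr qstep (replicate m 2 @ [4] @ replicate m 2 @ [3]) z = z"
    by (simp only: foldr_append foldr.simps comp_def id_def s3 t3 s4 t4)
  have "foldr qstep (replicate 2 2) z = qfrac (1 + q ^ 3 * p) 1"
    unfolding z_def by (rule foldr_qstep_twos_frac)
       (simp_all add: q0 q_def[symmetric] fps_bit_ring_simps)
  thus "foldr qstep [2, 2] z = 1 + q ^ 3 * p"
    by (simp add: qfrac_1 numeral_2_eq_2)
  show "fps_nth z 0 = 1" by (simp add: z_def qfrac_nth_0 q0)
qed

section \<open>The points of the theorem\<close>

lemma Phi2_RPlus_2: "RPlus 2 \<in> cantor_line1 \<and> Phi2 (RPlus 2) = 1 + fps_X ^ 1"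
proof -
  \<comment> \<open>The infinite expansion of 2, since the constant expansion 2, 2, ... has value 1.\<close>
  let ?c = "ev_periodic [3] [2] :: nat \<Rightarrow> nat"
  have c: "\<forall>j. ?c j \<ge> 2" by (intro ev_periodic_ge) auto
  \<comment> \<open>The conditional, read as a function of the index 0, lists the tails 2, 1, 1, ...\<close>
  have "hjval ?c = (if (0::nat) = 0 then 2 else 1)"
    using c by (rule hjval_eqI) (auto simp: hjstep_def ev_periodic_def)
  hence "Phi2 (RPlus 2) = qlim ?c" using c by (intro Phi2_hjval) simp_all
  also have "\<dots> = qstep 3 (qlim (ev_periodic [] [2]))"
    using qlim_ev_periodic[of "[3]" "[]" "[2]"] by simp
  also have "qlim (ev_periodic [] [2]) = (1 :: bit fps)"
    by (rule qlim_periodic_eqI) (simp_all add: qstep_2_one)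
  finally show ?thesis by (simp add: qstep_3_one cantor_line1_simps)
qed

lemma Phi2_RMinus_2: "RMinus 2 \<in> cantor_line1 \<and> Phi2 (RMinus 2) = 1 + fps_X ^ 2"
proof -
  have "hj_fin_digits 2 = [2]" by (rule hj_fin_digits_eq) simp_all
  hence "Phi2 (RMinus 2) = qstep 2 qinfty" by (simp add: reduce2_qrat_minus)
  also have "\<dots> = 1 + fps_X ^ 2"
    by (simp add: qstep_2 one_inv_qinfty fps_bit_ring_simps)
  finally show ?thesis by (simp add: cantor_line1_simps)
qed

definition monomial_digits :: "nat \<Rightarrow> nat \<Rightarrow> nat" where
  "monomial_digits n = ev_periodic [2, 2] (replicate (n - 3) 2 @ [4] @ replicate (n - 3) 2 @ [3])"

lemma monomial_digits_ge_2: "\<forall>j. monomial_digits n j \<ge> 2"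
  unfolding monomial_digits_def by (intro ev_periodic_ge) auto

lemma qlim_monomial_digits:
  assumes "n \<ge> 3"
  shows "qlim (monomial_digits n) = (1 + fps_X ^ n :: bit fps)"
proof -
  let ?per = "replicate (n - 3) 2 @ [4] @ replicate (n - 3) 2 @ [3] :: nat list"
  note pm = period_mod_2[of "n - 3"]
  have "qlim (monomial_digits n) = (foldr qstep [2, 2] (qlim (ev_periodic [] ?per)) :: bit fps)"
    using qlim_ev_periodic[of "[2, 2]" "[]" ?per] by (auto simp: monomial_digits_def)
  also have "\<dots> = 1 + fps_X ^ 3 * fps_X ^ (n - 3)"
    by (subst qlim_periodic_eqI[OF _ _ pm(3,1)]) (auto simp only: pm(2), auto)
  finally show ?thesis using assms by (simp add: power_add[symmetric])
qed

lemma hjval_monomial_digits: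
  assumes "n \<ge> 3"
  defines "x \<equiv> hjval (monomial_digits n)"
  shows "0 < x - 1" "x - 1 < 1"
    "(2 * real n - 1) * ((x - 1)\<^sup>2 + 1) = 2 * (real n ^ 2 - real n + 1) * (x - 1)"
proof -
  let ?per = "replicate (n - 3) 2 @ [4] @ replicate (n - 3) 2 @ [3] :: nat list"
  define z where "z = hjval (ev_periodic [] ?per)"
  have per: "\<forall>c\<in>set ?per. c \<ge> 2" by auto
  have "z \<ge> 1" unfolding z_def by (intro hjval_ge_1 ev_periodic_ge) auto
  moreover have "foldr hjstep ?per z = z"
  proof -
    have ne: "?per \<noteq> []" by simp
    have "hjval (ev_periodic (?per @ []) ?per) = foldr hjstep ?per (hjval (ev_periodic [] ?per))"
      using per ne by (intro hjval_ev_periodic) simp_all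
    from this[unfolded append_Nil2 ev_periodic_unroll[OF ne, symmetric]] show ?thesis
      unfolding z_def by (rule sym)
  qed
  ultimately have z: "z > 1" and
    quad: "(2 * real (n - 3) + 5) * ((2 + 1 / (z - 1))\<^sup>2 + 1) =
      2 * (real (n - 3) ^ 2 + 5 * real (n - 3) + 7) * (2 + 1 / (z - 1))"
    using hjstep_surd_period by blast+
  define W where "W = 2 + 1 / (z - 1)"
  have W: "W > 2" using z by (simp add: W_def)
  have "x = foldr hjstep (replicate 2 2) z"
    using hjval_ev_periodic[of "[2, 2]" "[]" ?per] per
    by (auto simp: x_def monomial_digits_def z_def numeral_2_eq_2)
  with foldr_hjstep_twos[OF z, of 2] have "x > 1" "1 / (x - 1) = W" by (simp_all add: W_def)
  hence x: "x - 1 = 1 / W" by auto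
  show "0 < x - 1" "x - 1 < 1" using W by (simp_all add: x)
  have "real (n - 3) = real n - 3" using assms by simp
  hence "(2 * real n - 1) * (W\<^sup>2 + 1) = 2 * (real n ^ 2 - real n + 1) * W"
    using quad unfolding W_def[symmetric] by (simp add: algebra_simps power2_eq_square)
  hence "(2 * real n - 1) * (W\<^sup>2 + 1) / W\<^sup>2 = 2 * (real n ^ 2 - real n + 1) * W / W\<^sup>2" by simp
  moreover have "(1 / W)\<^sup>2 + 1 = (W\<^sup>2 + 1) / W\<^sup>2" "1 / W = W / W\<^sup>2"
    using W by (simp_all add: field_simps power2_eq_square)
  ultimately show "(2 * real n - 1) * ((x - 1)\<^sup>2 + 1) = 2 * (real n ^ 2 - real n + 1) * (x - 1)"
    by (simp add: x)
qed

lemma hjval_monomial_digits_eq: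
  assumes "n \<ge> 3"
  shows "hjval (monomial_digits n) =
    (real n * (real n + 1) - sqrt ((real n - 2) * (real n - 1) * real n * (real n + 1)))
      / (2 * real n - 1)"
proof -
  let ?x = "hjval (monomial_digits n)"
  let ?b = "real n ^ 2 - real n + 1" and ?a = "2 * real n - 1"
  note h = hjval_monomial_digits[OF assms]
  have a: "?a > 0" using assms by simp
  have "?x - 1 = (?b - sqrt (?b\<^sup>2 - ?a\<^sup>2)) / ?a"
    by (rule reciprocal_quadratic_solution[OF h(1,2) a h(3)])
  moreover have "?b\<^sup>2 - ?a\<^sup>2 = (real n - 2) * (real n - 1) * real n * (real n + 1)"
    by (simp add: algebra_simps power2_eq_square)
  ultimately have "?x = 1 + (?b - sqrt ((real n - 2) * (real n - 1) * real n * (real n + 1))) / ?a"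
    by simp
  also have "\<dots> = (?a + (?b - sqrt ((real n - 2) * (real n - 1) * real n * (real n + 1)))) / ?a"
  proof -
    have "1 + t / d = (d + t) / d" if "d > 0" for d t :: real
      using that by (simp add: add_divide_distrib)
    from this[OF a] show ?thesis .
  qed
  also have "?a + (?b - sqrt ((real n - 2) * (real n - 1) * real n * (real n + 1))) =
      real n * (real n + 1) - sqrt ((real n - 2) * (real n - 1) * real n * (real n + 1))"
    by (simp add: distrib_left power2_eq_square)
  finally show ?thesis .
qed

text \<open>
  With \<open>t = n\<^sup>2 - n\<close> the radicand is \<open>t (t - 2) = (t - 1)\<^sup>2 - 1\<close>, which lies strictly between two
  consecutive squares.
\<close>

lemma quadratic_irrational_hjval_monomial_digits:
  assumes "n \<ge> 3"
  shows "quadratic_irrational (hjval (monomial_digits n))"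
proof -
  let ?x = "hjval (monomial_digits n)"
  define k where "k = n - 3"
  have n: "n = k + 3" using assms by (simp add: k_def)
  let ?D = "(k + 1) * (k + 2) * (k + 3) * (k + 4)"
  have "sqrt (real ?D) \<notin> \<rat>"
  proof (rule sqrt_irrational_between_squares)
    \<comment> \<open>The square root of \<open>(t - 1)\<^sup>2 - 1\<close> lies between \<open>t - 2\<close> and \<open>t - 1\<close>, and \<open>t - 2 = k\<^sup>2 + 5 k + 4\<close>.\<close>
    show "(k * k + 5 * k + 4)\<^sup>2 < ?D" "?D < (k * k + 5 * k + 4 + 1)\<^sup>2"
      by (simp_all add: algebra_simps power2_eq_square)
  qed
  moreover have "sqrt (real ?D) = real n * (real n + 1) - (2 * real n - 1) * ?x"
  proof -
    have "real ?D = (real n - 2) * (real n - 1) * real n * (real n + 1)"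
      by (simp add: n algebra_simps)
    moreover have "2 * real n - 1 \<noteq> 0" using assms by simp
    ultimately show ?thesis unfolding hjval_monomial_digits_eq[OF assms] by simp
  qed
  ultimately have "?x \<notin> \<rat>" by auto
  moreover have "of_int (2 * int n - 1) * ?x\<^sup>2 + of_int (- 2 * (int n * int n + int n)) * ?x
      + of_int (2 * (int n * int n + int n)) = 0"
    using hjval_monomial_digits(3)[OF assms] by (simp add: algebra_simps power2_eq_square)
  moreover have "2 * int n - 1 \<noteq> 0" by presburger
  ultimately show ?thesis unfolding quadratic_irrational_def by blast
qed

lemma Phi2_Irr_monomial_digits:
  assumes "n \<ge> 3"
  shows "Irr (hjval (monomial_digits n)) \<in> cantor_line1"
    and "Phi2 (Irr (hjval (monomial_digits n))) = 1 + fps_X ^ n"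
proof -
  have irr: "hjval (monomial_digits n) \<notin> \<rat>"
    using quadratic_irrational_hjval_monomial_digits[OF assms] by (simp add: quadratic_irrational_def)
  thus "Irr (hjval (monomial_digits n)) \<in> cantor_line1"
    using hjval_monomial_digits(1)[OF assms] by (simp add: cantor_line1_simps)
  show "Phi2 (Irr (hjval (monomial_digits n))) = 1 + fps_X ^ n"
    using Phi2_hjval(1)[OF monomial_digits_ge_2 irr] by (simp only: qlim_monomial_digits[OF assms])
qed

lemma Phi2_xpt:
  assumes "n \<ge> 1"
  shows "xpt n \<in> cantor_line1" "Phi2 (xpt n) = 1 + fps_X ^ n"
proof -
  consider "n = 1" | "n = 2" | "n \<ge> 3" using assms by linarith
  hence "\<exists>a\<in>cantor_line1. Phi2 a = 1 + fps_X ^ n"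
    by cases (use Phi2_RPlus_2 Phi2_RMinus_2 Phi2_Irr_monomial_digits in blast)+
  thus "xpt n \<in> cantor_line1" "Phi2 (xpt n) = 1 + fps_X ^ n" using xpt_eqI by blast+
qed

lemma fps_bit_eq_one_plus_X_power:
  fixes f :: "bit fps"
  assumes "fps_nth f 0 = 1" "\<exists>!k. k \<ge> 1 \<and> fps_nth f k \<noteq> 0"
  obtains n where "n \<ge> 1" "f = 1 + fps_X ^ n"
proof -
  from assms(2) obtain n where n: "n \<ge> 1" "fps_nth f n \<noteq> 0"
    "\<And>k. k \<ge> 1 \<Longrightarrow> fps_nth f k \<noteq> 0 \<Longrightarrow> k = n" by blast
  have "f = 1 + fps_X ^ n"
  proof (rule fps_ext)
    fix k
    consider "k = 0" | "k = n" | "k \<ge> 1" "k \<noteq> n" by linarith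
    thus "fps_nth f k = fps_nth (1 + fps_X ^ n) k"
    proof cases
      case 3
      hence "fps_nth f k = 0" using n(3) by blast
      with 3 show ?thesis by simp
    qed (use n(1,2) assms(1) in simp_all)
  qed
  with n(1) show ?thesis by (rule that)
qed

theorem proposition8p7:
  shows
    "(\<forall>n\<ge>1. xpt n \<in> cantor_line1 \<and> Phi2 (xpt n) = 1 + fps_X ^ n) \<and>
     xpt 1 = RPlus 2 \<and>
     xpt 2 = RMinus 2 \<and>
     (\<forall>n\<ge>3. \<exists>x::real.
        xpt n = Irr x \<and>
        hj_expansion
          (ev_periodic [2, 2] (replicate (n - 3) 2 @ [4] @ replicate (n - 3) 2 @ [3])) x \<and>
        x = (real n * (real n + 1)
               - sqrt ((real n - 2) * (real n - 1) * real n * (real n + 1)))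
              / (2 * real n - 1) \<and>
        quadratic_irrational x) \<and>
     {xpt n |n. n \<ge> 1} =
       {a \<in> cantor_line1. \<exists>!k. k \<ge> 1 \<and> fps_nth (Phi2 a) k \<noteq> 0}"
proof (intro conjI allI impI)
  fix n :: nat assume n: "n \<ge> 3"
  let ?x = "hjval (monomial_digits n)"
  have "xpt n = Irr ?x" using Phi2_Irr_monomial_digits[OF n] by (rule xpt_eqI)
  moreover have "hj_expansion (monomial_digits n) ?x"
    by (simp add: hj_expansion_iff monomial_digits_ge_2)
  ultimately show "\<exists>x::real. xpt n = Irr x \<and>
        hj_expansion
          (ev_periodic [2, 2] (replicate (n - 3) 2 @ [4] @ replicate (n - 3) 2 @ [3])) x \<and>
        x = (real n * (real n + 1)
               - sqrt ((real n - 2) * (real n - 1) * real n * (real n + 1)))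
              / (2 * real n - 1) \<and>
        quadratic_irrational x"
    using hjval_monomial_digits_eq[OF n] quadratic_irrational_hjval_monomial_digits[OF n]
    unfolding monomial_digits_def[symmetric] by blast
next
  show "{xpt n |n. n \<ge> 1} = {a \<in> cantor_line1. \<exists>!k. k \<ge> 1 \<and> fps_nth (Phi2 a) k \<noteq> 0}"
  proof (intro equalityI subsetI)
    fix a assume "a \<in> {xpt n |n. n \<ge> 1}"
    then obtain n where n: "n \<ge> 1" "a = xpt n" by blast
    have "k \<ge> 1 \<and> fps_nth (Phi2 a) k \<noteq> 0 \<longleftrightarrow> k = n" for k
      using n Phi2_xpt(2)[OF n(1)] by (auto simp: fps_one_def)
    thus "a \<in> {a \<in> cantor_line1. \<exists>!k. k \<ge> 1 \<and> fps_nth (Phi2 a) k \<noteq> 0}"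
      using Phi2_xpt(1)[OF n(1)] n(2) by simp
  next
    fix a assume a: "a \<in> {a \<in> cantor_line1. \<exists>!k. k \<ge> 1 \<and> fps_nth (Phi2 a) k \<noteq> 0}"
    then obtain n where "n \<ge> 1" "Phi2 a = 1 + fps_X ^ n"
      using fps_bit_eq_one_plus_X_power[OF Phi2_nth_0] by blast
    moreover from a this have "xpt n = a" by (intro xpt_eqI) auto
    ultimately show "a \<in> {xpt n |n. n \<ge> 1}" by blast
  qed
next
  show "xpt 1 = RPlus 2" using Phi2_RPlus_2 by (intro xpt_eqI) blast+
  show "xpt 2 = RMinus 2" using Phi2_RMinus_2 by (intro xpt_eqI) blast+
qed (intro Phi2_xpt; assumption)+

end
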